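(* The algorithm PA-I is stable, i.e., for each $n\in\{0,\dots,N-1\}$ and each $k\ge 0$ its iterates satisfy $$\|U_{n+1}^{k+1}\|\le \|u^{0}\|+(n+1)\Big(\max_{0\le j\le n}\|U_j^{k}\|\Big).$$
   Context: Let $h>0$, let $N_x\ge 3$ be an integer, and let $D_h=\frac1{h^2}\,\mathrm{tridiag}(1,-2,1)\in\mathbb{R}^{(N_x-2)\times(N_x-2)}$ be the discrete Dirichlet Laplacian (diagonal entries $-2/h^2$, sub- and superdiagonal entries $1/h^2$, all others $0$). Let $\epsilon>0$, $T>0$, integers $N\ge1$ and $J\ge2$, $\Delta T=T/N$, $\Delta t=\Delta T/J$, $T_n=n\Delta T$. $\|\cdot\|$ is the Euclidean norm on $\mathbb{R}^{N_x-2}$ and the induced matrix norm. For $i\in\{1,2\}$ set $$P_i=(I-i\Delta T D_h+\epsilon^2\Delta T D_h^2)^{-1}(I-i\Delta T D_h),\qquad P_{J_i}=\Big[\big(I-\tfrac{i\Delta T}{J}D_h+\epsilon^2\tfrac{\Delta T}{J}D_h^2\big)^{-1}\big(I-\tfrac{i\Delta T}{J}D_h\big)\Big]^J .$$ Parareal iteration: given a fine propagator $\mathcal F$ and a coarse propagator $\mathcal G$ (maps $\mathbb{R}^{N_x-2}\to\mathbb{R}^{N_x-2}$ advancing the solution from $T_n$ to $T_{n+1}$) and $u^0\in\mathbb{R}^{N_x-2}$, the initial guess is $U_0^0=u^0$, $U_{n+1}^0=\mathcal G(U_n^0)$, and for $k=0,1,2,\dots$ $$U_0^{k+1}=u^0,\qquad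 U_{n+1}^{k+1}=\mathcal G(U_n^{k+1})+\mathcal F(U_n^k)-\mathcal G(U_n^k),\quad 0\le n\le N-1.$$ PA-I (in the form analyzed): the Parareal iteration with $\mathcal F(U)=P_{J_1}U$ and $\mathcal G(U)=P_1U$. These are the propagators of the linearized convex-splitting scheme $\frac{W^{n+1}-W^n}{\Delta t}=D_h\,\mathrm{diag}(W^n)^2W^{n+1}-\epsilon^2D_h^2W^{n+1}-D_hW^n$ for the Cahn-Hilliard equation, with the term $\mathrm{diag}(W^n)^2$ replaced by $I$; $\mathcal F$ takes $J$ steps of size $\Delta t$ and $\mathcal G$ one step of size $\Delta T$. *)

theory Defs
  imports "HOL-Analysis.Analysis"
begin

text \<open>
  Real vectors of length \<open>N\<^sub>x - 2\<close> are elements of \<open>real ^ 'm\<close> for an index type \<open>'m\<close> with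
  \<open>CARD('m) = N\<^sub>x - 2\<close>. Band matrices need an ordering of the indices, so \<open>'m\<close> is a finite linear
  order; the position of an index (counted from 0) is the number of its predecessors.
\<close>

definition index_pos :: "'m::{finite,linorder} \<Rightarrow> nat" where
  "index_pos i = card {j. j < i}"

definition tridiag :: "real \<Rightarrow> real \<Rightarrow> real \<Rightarrow> real ^ ('m::{finite,linorder}) ^ 'm::{finite,linorder}" where
  "tridiag a b c =
    (\<chi> i j. if index_pos i = index_pos j + 1 then a
           else if index_pos i = index_pos j then b
           else if index_pos j = index_pos i + 1 then c
           else 0)"

definition dirichlet_laplacian :: "real \<Rightarrow> real ^ ('m::{finite,linorder}) ^ 'm::{finite,linorder}" where
  "dirichlet_laplacian h = (1 / h\<^sup>2) *\<^sub>R tridiag 1 (-2) 1"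

text \<open>
  The power operation that the type \<open>real ^ 'm ^ 'm\<close> inherits from the type classes is entrywise,
  so the power with respect to \<open>**\<close> is defined separately.
\<close>

definition matrix_power :: "real ^ ('m::{finite,linorder}) ^ 'm::{finite,linorder} \<Rightarrow> nat \<Rightarrow> real ^ ('m::{finite,linorder}) ^ 'm::{finite,linorder}" where
  "matrix_power A p = (((**) A) ^^ p) (mat 1)"

text \<open>
  For \<open>i = 1\<close>, \<open>W' = step_matrix 1 h \<epsilon> \<tau> *v W\<close> solves
  \<open>(W' - W) / \<tau> = D W' - \<epsilon>\<^sup>2 D\<^sup>2 W' - D W\<close>, the convex-splitting scheme for the Cahn-Hilliard
  equation with \<open>diag(W)\<^sup>2\<close> replaced by the identity. The matrix inverted here is positive definite
  for \<open>\<tau> > 0\<close>, so the inverse is a genuine one.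
\<close>

definition step_matrix ::
  "nat \<Rightarrow> real \<Rightarrow> real \<Rightarrow> real \<Rightarrow> real ^ ('m::{finite,linorder}) ^ 'm::{finite,linorder}" where
  "step_matrix i h \<epsilon> \<tau> =
    (let D = dirichlet_laplacian h in
      matrix_inv (mat 1 - (real i * \<tau>) *\<^sub>R D + (\<epsilon>\<^sup>2 * \<tau>) *\<^sub>R (D ** D))
        ** (mat 1 - (real i * \<tau>) *\<^sub>R D))"

definition coarse_matrix ::
  "nat \<Rightarrow> real \<Rightarrow> real \<Rightarrow> real \<Rightarrow> real ^ ('m::{finite,linorder}) ^ 'm::{finite,linorder}" where
  "coarse_matrix i h \<epsilon> \<Delta>T = step_matrix i h \<epsilon> \<Delta>T"

definition fine_matrix ::
  "nat \<Rightarrow> real \<Rightarrow> real \<Rightarrow> real \<Rightarrow> nat \<Rightarrow> real ^ ('m::{finite,linorder}) ^ 'm::{finite,linorder}" where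
  "fine_matrix i h \<epsilon> \<Delta>T J = matrix_power (step_matrix i h \<epsilon> (\<Delta>T / real J)) J"

text \<open>
  \<open>parareal F G u0 k n\<close> is the iterate \<open>U\<^sub>n\<^sup>k\<close>. The recursion also runs past the last time
  level \<open>N\<close>; the values at levels up to \<open>N\<close> do not depend on later ones.
\<close>

fun parareal :: "('v::ab_group_add \<Rightarrow> 'v) \<Rightarrow> ('v \<Rightarrow> 'v) \<Rightarrow> 'v \<Rightarrow> nat \<Rightarrow> nat \<Rightarrow> 'v" where
  "parareal F G u0 k 0 = u0"
| "parareal F G u0 0 (Suc n) = G (parareal F G u0 0 n)"
| "parareal F G u0 (Suc k) (Suc n) =
    G (parareal F G u0 (Suc k) n) + F (parareal F G u0 k n) - G (parareal F G u0 k n)"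

definition PA_I ::
  "real \<Rightarrow> real \<Rightarrow> real \<Rightarrow> nat \<Rightarrow> real ^ 'm::{finite,linorder} \<Rightarrow> nat \<Rightarrow> nat \<Rightarrow> real ^ 'm::{finite,linorder}" where
  "PA_I h \<epsilon> \<Delta>T J =
    parareal (\<lambda>U. fine_matrix 1 h \<epsilon> \<Delta>T J *v U) (\<lambda>U. coarse_matrix 1 h \<epsilon> \<Delta>T *v U)"

end

theory Submission
  imports Defs
begin

text \<open>
  The matrix \<open>D\<close> is symmetric and negative semidefinite, so each eigenvalue \<open>-x\<close> of \<open>D\<close> has
  \<open>x \<ge> 0\<close> and gives the one-step propagator with step size \<open>\<tau>\<close> the eigenvalue
  \<open>(1 + \<tau> x) / (1 + \<tau> x + \<epsilon>\<^sup>2 \<tau> x\<^sup>2) \<in> (0, 1]\<close>. The eigenvalues of \<open>\<G>\<close> and of \<open>\<F>\<close>, a power of a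
  one-step propagator, therefore lie in \<open>(0, 1]\<close>. Since the two are symmetric, this yields both
  \<open>\<parallel>\<G>\<parallel> \<le> 1\<close> and \<open>\<parallel>\<F> - \<G>\<parallel> \<le> 1\<close>. The second bound is the essential one: contractivity of \<open>\<F>\<close> and
  \<open>\<G>\<close> alone would only give \<open>2\<close>. Writing the iteration as
  \<open>U\<^sub>n\<^sub>+\<^sub>1\<^sup>k\<^sup>+\<^sup>1 = \<G> U\<^sub>n\<^sup>k\<^sup>+\<^sup>1 + (\<F> - \<G>) U\<^sub>n\<^sup>k\<close>, each time step adds at most \<open>\<parallel>U\<^sub>n\<^sup>k\<parallel>\<close> to the norm, and
  summing over the time steps proves the claim.

  No diagonalization is carried out. The spectral statement is replaced by the operator inequality
  \<open>0 \<le> f \<le> I\<close> between quadratic forms of self-adjoint maps (\<open>positive_contraction\<close>). It holds for a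
  one-step propagator (\<open>positive_contraction_rational\<close>), passes to powers
  (\<open>positive_contraction_funpow\<close>), and bounds the norm of a difference
  (\<open>positive_contraction_diff_norm_le\<close>), because for self-adjoint maps the quadratic form
  controls the norm (\<open>self_adjoint_norm_le\<close>).
\<close>

section \<open>Self-adjoint maps between zero and the identity\<close>

definition self_adjoint :: "('a::real_inner \<Rightarrow> 'a) \<Rightarrow> bool" where
  "self_adjoint f \<longleftrightarrow> linear f \<and> (\<forall>x y. f x \<bullet> y = x \<bullet> f y)"

definition positive_contraction :: "('a::real_inner \<Rightarrow> 'a) \<Rightarrow> bool" where
  "positive_contraction f \<longleftrightarrow> self_adjoint f \<and> (\<forall>x. 0 \<le> f x \<bullet> x \<and> f x \<bullet> x \<le> x \<bullet> x)"

text \<open>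
  Polarization turns the bound on the quadratic form into one on the bilinear form,
  \<open>2 \<langle>f x, y\<rangle> \<le> \<parallel>x\<parallel>\<^sup>2 + \<parallel>y\<parallel>\<^sup>2\<close>; then \<open>y\<close> is chosen parallel to \<open>f x\<close> and of the same length as \<open>x\<close>.
\<close>

lemma self_adjoint_norm_le:
  assumes f: "self_adjoint f" and bound: "\<And>x. \<bar>f x \<bullet> x\<bar> \<le> x \<bullet> x"
  shows "norm (f x) \<le> norm x"
proof (cases "f x = 0")
  case False
  have lin: "linear f" and sym: "\<And>x y. f x \<bullet> y = x \<bullet> f y"
    using f by (auto simp: self_adjoint_def)
  have polar: "2 * (f x \<bullet> y) \<le> x \<bullet> x + y \<bullet> y" for y
  proof -
    have "4 * (f x \<bullet> y) = f (x + y) \<bullet> (x + y) - f (x - y) \<bullet> (x - y)"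
      using sym[of y x]
      by (simp add: linear_add[OF lin] linear_diff[OF lin] inner_simps inner_commute)
    also have "\<dots> \<le> (x + y) \<bullet> (x + y) + (x - y) \<bullet> (x - y)"
      using bound[of "x + y"] bound[of "x - y"] by linarith
    also have "\<dots> = 2 * (x \<bullet> x + y \<bullet> y)"
      by (simp add: inner_simps inner_commute)
    finally show ?thesis by simp
  qed
  define y where "y = (norm x / norm (f x)) *\<^sub>R f x"
  have "f x \<bullet> y = norm x * norm (f x)" and "y \<bullet> y = norm x * norm x"
    using False by (simp_all add: y_def dot_square_norm power2_eq_square)
  with polar[of y] have "norm x * norm (f x) \<le> norm x * norm x"
    by (simp add: dot_square_norm power2_eq_square)
  moreover have "norm x > 0"
    using False linear_0[OF lin] by auto
  ultimately show ?thesis by simp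
qed simp

lemma positive_contraction_norm_le:
  assumes "positive_contraction f"
  shows "norm (f x) \<le> norm x"
  using assms by (intro self_adjoint_norm_le) (auto simp: positive_contraction_def)

text \<open>
  Subtracting \<open>0 \<le> g \<le> I\<close> from \<open>0 \<le> f \<le> I\<close> gives \<open>-I \<le> f - g \<le> I\<close>; positivity is what saves the factor
  \<open>2\<close> of the triangle inequality.
\<close>

lemma positive_contraction_diff_norm_le:
  assumes "positive_contraction f" and "positive_contraction g"
  shows "norm (f x - g x) \<le> norm x"
proof (rule self_adjoint_norm_le[where f = "\<lambda>x. f x - g x"])
  show "self_adjoint (\<lambda>x. f x - g x)"
    using assms
    by (auto simp: positive_contraction_def self_adjoint_def inner_diff_left inner_diff_right
        intro: linear_compose_sub)
  show "\<bar>(f x - g x) \<bullet> x\<bar> \<le> x \<bullet> x" for x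
  proof -
    have "0 \<le> f x \<bullet> x" "f x \<bullet> x \<le> x \<bullet> x" "0 \<le> g x \<bullet> x" "g x \<bullet> x \<le> x \<bullet> x"
      using assms by (auto simp: positive_contraction_def)
    then show ?thesis by (simp add: inner_diff_left abs_le_iff)
  qed
qed

text \<open>
  Induction in steps of two: moving one factor \<open>f\<close> to the other side of the inner product gives
  \<open>\<langle>f\<^sup>n\<^sup>+\<^sup>2 x, x\<rangle> = \<langle>f\<^sup>n (f x), f x\<rangle>\<close>.
\<close>

lemma positive_contraction_funpow:
  assumes f: "positive_contraction f"
  shows "positive_contraction (f ^^ n)"
proof (induction n rule: induct_nat_012)
  case 0
  show ?case by (simp add: positive_contraction_def self_adjoint_def linear_iff)
next
  case 1
  show ?case using f by (simp add: eval_nat_numeral)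
next
  case (ge2 n)
  have lin: "linear f" and sym: "\<And>x y. f x \<bullet> y = x \<bullet> f y"
    and sym_n: "\<And>x y. (f ^^ n) x \<bullet> y = x \<bullet> (f ^^ n) y" and lin_n: "linear (f ^^ n)"
    and bound_n: "\<And>x. 0 \<le> (f ^^ n) x \<bullet> x \<and> (f ^^ n) x \<bullet> x \<le> x \<bullet> x"
    using f ge2 by (auto simp: positive_contraction_def self_adjoint_def)
  have split: "(f ^^ Suc (Suc n)) x = f ((f ^^ n) (f x))" for x
    by (simp add: funpow_swap1)
  have "linear (f ^^ Suc (Suc n))"
    using linear_compose[OF linear_compose[OF lin_n lin] lin] by (simp add: o_assoc)
  moreover have "(f ^^ Suc (Suc n)) x \<bullet> y = x \<bullet> (f ^^ Suc (Suc n)) y" for x y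
    unfolding split by (simp only: sym sym_n)
  moreover have "(f ^^ Suc (Suc n)) x \<bullet> x = (f ^^ n) (f x) \<bullet> f x" for x
    unfolding split by (rule sym)
  moreover have "f x \<bullet> f x \<le> x \<bullet> x" for x
    using positive_contraction_norm_le[OF f, of x] by (simp add: norm_le)
  ultimately show ?case
    using bound_n unfolding positive_contraction_def self_adjoint_def
    by (metis order_trans)
qed

text \<open>
  In terms of \<open>L\<close>, the map \<open>f\<close> is \<open>(I - \<tau> L) (I - \<tau> L + c L\<^sup>2)\<^sup>-\<^sup>1\<close>. The substitution
  \<open>x = (I - \<tau> L + c L\<^sup>2) y\<close> removes the inverse, and both inequalities reduce to
  \<open>\<langle>(I - \<tau> L) y, L\<^sup>2 y\<rangle> = \<parallel>L y\<parallel>\<^sup>2 - \<tau> \<langle>L (L y), L y\<rangle> \<ge> 0\<close>.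
\<close>

lemma positive_contraction_rational:
  assumes L: "self_adjoint L" and neg: "\<And>x. L x \<bullet> x \<le> 0" and "\<tau> \<ge> 0" and "c \<ge> 0"
    and lin: "linear f"
    and surj: "surj (\<lambda>y. y - \<tau> *\<^sub>R L y + c *\<^sub>R L (L y))"
    and f: "\<And>y. f (y - \<tau> *\<^sub>R L y + c *\<^sub>R L (L y)) = y - \<tau> *\<^sub>R L y"
  shows "positive_contraction f"
proof -
  define A where "A y = y - \<tau> *\<^sub>R L y" for y
  define B where "B y = A y + c *\<^sub>R L (L y)" for y
  have fB: "f (B y) = A y" for y
    using f by (simp add: A_def B_def)
  have ex: "\<exists>y. x = B y" for x
    using surj by (auto simp: A_def B_def surj_def)
  have sym: "L x \<bullet> y = x \<bullet> L y" for x y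
    using L by (simp add: self_adjoint_def)
  have linL: "linear L"
    using L by (simp add: self_adjoint_def)
  have cross: "A y \<bullet> L (L z) = L (L y) \<bullet> A z" for y z
  proof -
    have "L y \<bullet> L (L z) = L (L y) \<bullet> L z" and "y \<bullet> L (L z) = L (L y) \<bullet> z"
      by (simp_all add: sym)
    then show ?thesis
      by (simp add: A_def inner_simps)
  qed
  have cross_nonneg: "A y \<bullet> L (L y) \<ge> 0" for y
  proof -
    have "A y \<bullet> L (L y) = L y \<bullet> L y - \<tau> * (L (L y) \<bullet> L y)"
      by (simp add: A_def inner_simps sym[of y "L y", symmetric] inner_commute)
    moreover have "\<tau> * (L (L y) \<bullet> L y) \<le> 0"
      using neg[of "L y"] \<open>\<tau> \<ge> 0\<close> by (simp add: mult_nonneg_nonpos)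
    ultimately show ?thesis
      using inner_ge_zero[of "L y"] by linarith
  qed
  have "f x \<bullet> z = x \<bullet> f z" for x z
  proof -
    obtain x' z' where "x = B x'" "z = B z'" using ex by blast
    moreover have "A x' \<bullet> B z' = B x' \<bullet> A z'"
      by (simp add: B_def inner_add_left inner_add_right cross)
    ultimately show ?thesis by (simp add: fB)
  qed
  moreover have "0 \<le> f x \<bullet> x \<and> f x \<bullet> x \<le> x \<bullet> x" for x
  proof -
    obtain y where x: "x = B y" using ex by blast
    have p: "0 \<le> c * (A y \<bullet> L (L y))"
      using \<open>c \<ge> 0\<close> cross_nonneg by simp
    have "f x \<bullet> x = A y \<bullet> A y + c * (A y \<bullet> L (L y))"
      by (simp add: x fB) (simp add: B_def inner_add_right)
    moreover have "x \<bullet> x = f x \<bullet> x + (c * (A y \<bullet> L (L y)) + c * c * (L (L y) \<bullet> L (L y)))"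
      by (simp add: x fB) (simp add: B_def inner_simps inner_commute algebra_simps)
    moreover have "0 \<le> c * c * (L (L y) \<bullet> L (L y))" by simp
    ultimately show ?thesis
      using p inner_ge_zero[of "A y"] by linarith
  qed
  ultimately show ?thesis
    using lin by (simp add: positive_contraction_def self_adjoint_def)
qed

section \<open>The discrete Dirichlet Laplacian\<close>

type_synonym 'm square_matrix = "((real, 'm) vec, 'm) vec"

lemma self_adjoint_matrix:
  fixes M :: "real ^ 'm ^ 'm"
  assumes "transpose M = M"
  shows "self_adjoint ((*v) M)"
proof -
  have "(M *v x) \<bullet> y = x \<bullet> (M *v y)" for x y
    using assms by (metis dot_lmul_matrix transpose_matrix_vector)
  then show ?thesis
    by (simp add: self_adjoint_def)
qed

text \<open>
  Diagonal dominance: by \<open>2 x\<^sub>i x\<^sub>j \<le> x\<^sub>i\<^sup>2 + x\<^sub>j\<^sup>2\<close> the quadratic form of a symmetric nonnegative matrix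
  is at most that of the diagonal matrix of its row sums.
\<close>

lemma quadratic_form_le_row_sum:
  fixes M :: "real ^ 'm ^ 'm"
  assumes sym: "transpose M = M" and nonneg: "\<And>i j. M $ i $ j \<ge> 0"
    and rows: "\<And>i. (\<Sum>j\<in>UNIV. M $ i $ j) \<le> b"
  shows "(M *v x) \<bullet> x \<le> b * (x \<bullet> x)"
proof -
  have swap: "M $ i $ j = M $ j $ i" for i j
    using sym by (metis transpose_def vec_lambda_beta)
  define S where "S = (\<Sum>i\<in>UNIV. \<Sum>j\<in>UNIV. M $ i $ j * (x $ i)\<^sup>2)"
  have S': "(\<Sum>i\<in>UNIV. \<Sum>j\<in>UNIV. M $ i $ j * (x $ j)\<^sup>2) = S"
    unfolding S_def by (subst sum.swap) (simp add: swap)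
  have "2 * ((M *v x) \<bullet> x) = (\<Sum>i\<in>UNIV. \<Sum>j\<in>UNIV. M $ i $ j * (2 * x $ i * x $ j))"
    by (simp add: inner_vec_def matrix_vector_mult_def sum_distrib_left sum_distrib_right algebra_simps)
  also have "\<dots> \<le> (\<Sum>i\<in>UNIV. \<Sum>j\<in>UNIV. M $ i $ j * ((x $ i)\<^sup>2 + (x $ j)\<^sup>2))"
    by (intro sum_mono mult_left_mono sum_squares_bound nonneg)
  also have "\<dots> = 2 * S"
    by (simp add: distrib_left sum.distrib S') (simp add: S_def)
  also have "S = (\<Sum>i\<in>UNIV. (\<Sum>j\<in>UNIV. M $ i $ j) * (x $ i)\<^sup>2)"
    by (simp add: S_def sum_distrib_right)
  also have "2 * \<dots> \<le> 2 * (\<Sum>i\<in>UNIV. b * (x $ i)\<^sup>2)"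
    by (intro mult_left_mono sum_mono mult_right_mono rows) auto
  also have "\<dots> = 2 * (b * (x \<bullet> x))"
    by (simp add: inner_vec_def sum_distrib_left power2_eq_square)
  finally show ?thesis by simp
qed

lemma index_pos_eq_iff: "index_pos i = index_pos j \<longleftrightarrow> i = j"
proof -
  have "index_pos i < index_pos j" if "i < j" for i j :: 'a
    unfolding index_pos_def using that by (intro psubset_card_mono) auto
  then show ?thesis
    by (metis less_irrefl linorder_cases)
qed

lemma transpose_tridiag: "transpose (tridiag a b a) = tridiag a b a"
  by (simp add: tridiag_def transpose_def vec_eq_iff)

text \<open>
  Each index has at most one neighbour on either side, because positions determine indices; the first
  and the last index lack one.
\<close>

lemma tridiag_adjacency_row_sum_le:
  "(\<Sum>j\<in>UNIV. (tridiag 1 0 1 :: 'm::{finite,linorder} square_matrix) $ i $ j) \<le> 2"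
proof -
  have single: "card {j::'m. index_pos j = p} \<le> 1" for p
    by (auto simp: card_le_Suc0_iff_eq index_pos_eq_iff[symmetric])
  have "(\<Sum>j\<in>UNIV. (tridiag 1 0 1 :: 'm square_matrix) $ i $ j)
      = (\<Sum>j::'m\<in>UNIV. if j \<in> {j. index_pos i = index_pos j + 1 \<or> index_pos j = index_pos i + 1} then 1 else 0)"
    by (intro sum.cong) (auto simp: tridiag_def)
  also have "\<dots> = real (card {j::'m. index_pos i = index_pos j + 1 \<or> index_pos j = index_pos i + 1})"
    by (subst sum.inter_restrict[symmetric]) auto
  also have "\<dots> \<le> real (card ({j::'m. index_pos j = index_pos i - 1} \<union> {j. index_pos j = index_pos i + 1}))"
    by (intro of_nat_mono card_mono) auto
  also have "\<dots> \<le> real (card {j::'m. index_pos j = index_pos i - 1} + card {j::'m. index_pos j = index_pos i + 1})"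
    by (intro of_nat_mono card_Un_le)
  also have "\<dots> \<le> 2"
    using single[of "index_pos i - 1"] single[of "index_pos i + 1"] by linarith
  finally show ?thesis .
qed

lemma dirichlet_laplacian_self_adjoint: "self_adjoint ((*v) (dirichlet_laplacian h))"
proof (rule self_adjoint_matrix)
  show "transpose (dirichlet_laplacian h) = dirichlet_laplacian h"
    by (simp add: dirichlet_laplacian_def transpose_scalar transpose_tridiag)
qed

lemma dirichlet_laplacian_nonpos: "(dirichlet_laplacian h *v x) \<bullet> x \<le> 0"
proof -
  have split: "tridiag 1 (-2) 1 = tridiag 1 0 1 - 2 *\<^sub>R (mat 1 :: 'a square_matrix)"
    by (auto simp: vec_eq_iff tridiag_def mat_def index_pos_eq_iff)
  have "(tridiag 1 0 1 *v x) \<bullet> x \<le> 2 * (x \<bullet> x)"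
    by (rule quadratic_form_le_row_sum[OF transpose_tridiag _ tridiag_adjacency_row_sum_le])
      (simp add: tridiag_def)
  then have "(tridiag 1 (-2) 1 *v x) \<bullet> x \<le> 0"
    by (simp add: split matrix_vector_mult_diff_rdistrib scaleR_matrix_vector_assoc[symmetric] inner_diff_left)
  then show ?thesis
    by (simp add: dirichlet_laplacian_def scaleR_matrix_vector_assoc[symmetric] divide_nonpos_nonneg)
qed

section \<open>The coarse and fine propagators\<close>

text \<open>
  The matrix \<open>B\<close> to be inverted satisfies \<open>\<langle>B y, y\<rangle> \<ge> \<parallel>y\<parallel>\<^sup>2\<close> and is thus invertible. It commutes with
  the explicit factor, so the propagator, defined with the inverse on the left, also has the form
  required by \<open>positive_contraction_rational\<close>.
\<close>

lemma step_matrix_positive_contraction: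
  fixes h \<epsilon> \<tau> :: real
  assumes "\<tau> \<ge> 0"
  shows "positive_contraction ((*v) (step_matrix i h \<epsilon> \<tau> :: 'm::{finite,linorder} square_matrix))"
proof -
  define D where "D = (dirichlet_laplacian h :: 'm square_matrix)"
  define s c where "s = real i * \<tau>" and "c = \<epsilon>\<^sup>2 * \<tau>"
  define A where "A = mat 1 - s *\<^sub>R D"
  define B where "B = A + c *\<^sub>R (D ** D)"
  have s: "s \<ge> 0" and c: "c \<ge> 0" using assms by (simp_all add: s_def c_def)
  have neg: "(D *v x) \<bullet> x \<le> 0" and sa: "self_adjoint ((*v) D)" for x
    by (simp_all add: D_def dirichlet_laplacian_nonpos dirichlet_laplacian_self_adjoint)
  have step: "step_matrix i h \<epsilon> \<tau> = matrix_inv B ** A"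
    by (simp add: step_matrix_def Let_def A_def B_def D_def s_def c_def)
  have A_apply: "A *v y = y - s *\<^sub>R (D *v y)" for y
    by (simp add: A_def matrix_vector_mult_diff_rdistrib scaleR_matrix_vector_assoc)
  have B_apply: "B *v y = y - s *\<^sub>R (D *v y) + c *\<^sub>R (D *v (D *v y))" for y
    by (simp add: B_def matrix_vector_mult_add_rdistrib A_apply scaleR_matrix_vector_assoc[symmetric]
        matrix_vector_mul_assoc)
  have "y = 0" if "B *v y = 0" for y
  proof -
    have "(D *v (D *v y)) \<bullet> y = (D *v y) \<bullet> (D *v y)"
      using sa by (simp add: self_adjoint_def)
    then have "(B *v y) \<bullet> y = y \<bullet> y - s * ((D *v y) \<bullet> y) + c * ((D *v y) \<bullet> (D *v y))"
      by (simp add: B_apply inner_simps)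
    moreover have "s * ((D *v y) \<bullet> y) \<le> 0" using s neg[of y] by (simp add: mult_nonneg_nonpos)
    moreover have "c * ((D *v y) \<bullet> (D *v y)) \<ge> 0" using c by simp
    ultimately have "y \<bullet> y \<le> 0" using that by simp
    then show ?thesis by (metis inner_gt_zero_iff linorder_not_le)
  qed
  then have "invertible B"
    by (metis matrix_left_invertible_ker invertible_left_inverse)
  then have inv: "matrix_inv B ** B = mat 1" "B ** matrix_inv B = mat 1"
    unfolding invertible_def matrix_inv_def by (metis (mono_tags, lifting) someI_ex)+
  have commute: "A *v (B *v y) = B *v (A *v y)" for y
    by (simp add: A_apply B_apply matrix_vector_mult_diff_distrib matrix_vector_right_distrib
        matrix_vector_mult_scaleR algebra_simps)
  show ?thesis
  proof (rule positive_contraction_rational[OF sa neg s c])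
    show "linear ((*v) (step_matrix i h \<epsilon> \<tau> :: 'm square_matrix))" by simp
    show "surj (\<lambda>y. y - s *\<^sub>R (D *v y) + c *\<^sub>R (D *v (D *v y)))"
    proof (rule surjI)
      show "(matrix_inv B *v x) - s *\<^sub>R (D *v (matrix_inv B *v x))
          + c *\<^sub>R (D *v (D *v (matrix_inv B *v x))) = x" for x
        unfolding B_apply[symmetric] by (simp add: matrix_vector_mul_assoc inv)
    qed
    show "step_matrix i h \<epsilon> \<tau> *v (y - s *\<^sub>R (D *v y) + c *\<^sub>R (D *v (D *v y))) = y - s *\<^sub>R (D *v y)" for y
    proof -
      have "matrix_inv B *v (A *v (B *v y)) = A *v y"
        unfolding commute by (simp add: matrix_vector_mul_assoc matrix_mul_assoc inv)
      then show ?thesis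
        unfolding B_apply[symmetric] unfolding A_apply[symmetric] step
        by (simp only: matrix_vector_mul_assoc[symmetric])
    qed
  qed
qed

lemma matrix_power_apply: "matrix_power A p *v x = (((*v) A) ^^ p) x"
  unfolding matrix_power_def by (induction p) (simp_all flip: matrix_vector_mul_assoc)

section \<open>Stability of the iteration\<close>

text \<open>
  Grouping the correction as \<open>F - G\<close> applied to the old iterate makes the growth in \<open>n\<close> additive:
  estimating its two terms separately would double every summand.
\<close>

lemma parareal_norm_le_sum:
  fixes F G :: "'v::real_normed_vector \<Rightarrow> 'v"
  assumes G: "\<And>x. norm (G x) \<le> norm x" and FG: "\<And>x. norm (F x - G x) \<le> norm x"
  shows "norm (parareal F G u0 (Suc k) n) \<le> norm u0 + (\<Sum>j<n. norm (parareal F G u0 k j))"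
proof (induction n)
  case (Suc n)
  have "norm (parareal F G u0 (Suc k) (Suc n))
      \<le> norm (G (parareal F G u0 (Suc k) n)) + norm (F (parareal F G u0 k n) - G (parareal F G u0 k n))"
    by (simp add: add_diff_eq[symmetric] norm_triangle_ineq del: add_diff_eq)
  also have "\<dots> \<le> norm (parareal F G u0 (Suc k) n) + norm (parareal F G u0 k n)"
    by (intro add_mono G FG)
  finally show ?case using Suc by simp
qed simp

theorem theorem3p6:
  fixes h \<epsilon> T :: real
    and Nx N J n k :: nat
    and u0 :: "real ^ 'm::{finite,linorder}"
  assumes "h > 0" and "Nx \<ge> 3" and "CARD('m) = Nx - 2"
    and "\<epsilon> > 0" and "T > 0" and "N \<ge> 1" and "J \<ge> 2"
    and "n \<in> {0..N - 1}"
  shows "norm (PA_I h \<epsilon> (T / real N) J u0 (k + 1) (n + 1))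
    \<le> norm u0 + real (n + 1) * (MAX j\<in>{0..n}. norm (PA_I h \<epsilon> (T / real N) J u0 k j))"
proof -
  define U where "U = PA_I h \<epsilon> (T / real N) J u0"
  have coarse: "positive_contraction ((*v) (coarse_matrix 1 h \<epsilon> (T / real N) :: 'm square_matrix))"
    unfolding coarse_matrix_def using \<open>T > 0\<close> by (intro step_matrix_positive_contraction) simp
  have "positive_contraction ((*v) (step_matrix 1 h \<epsilon> (T / real N / real J) :: 'm square_matrix))"
    using \<open>T > 0\<close> by (intro step_matrix_positive_contraction) simp
  from positive_contraction_funpow[OF this, of J]
  have fine: "positive_contraction ((*v) (fine_matrix 1 h \<epsilon> (T / real N) J :: 'm square_matrix))"
    by (simp add: fine_matrix_def matrix_power_apply[abs_def])
  have "norm (U (Suc k) (Suc n)) \<le> norm u0 + (\<Sum>j<Suc n. norm (U k j))"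
    unfolding U_def PA_I_def
    by (rule parareal_norm_le_sum positive_contraction_norm_le[OF coarse]
        positive_contraction_diff_norm_le[OF fine coarse])+
  moreover have "(\<Sum>j<Suc n. norm (U k j)) \<le> real (card {..<Suc n}) * (MAX j\<in>{0..n}. norm (U k j))"
    by (intro sum_bounded_above Max_ge) auto
  ultimately show ?thesis
    by (simp add: U_def)
qed

end
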